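(* Let $(X,\tau)$ be a topological space and let $\mathcal{I}$ be an admissible ideal on $\mathbb{N}$. Then the family $$\tau_{\mathcal{I}^{*}}:=\{U\in P(X): U \text{ is an } \mathcal{I}^{*}\text{-open set}\}$$ is a topology on $X$.
   Context: An ideal on $\mathbb{N}$ is a family $\mathcal{I}\subseteq P(\mathbb{N})$ such that $A\cup B\in\mathcal{I}$ for all $A,B\in\mathcal{I}$, and $B\in\mathcal{I}$ whenever $A\in\mathcal{I}$ and $B\subseteq A$. It is nontrivial if $\mathcal{I}\neq\emptyset$ and $\mathbb{N}\notin\mathcal{I}$, and admissible if $\{n\}\in\mathcal{I}$ for all $n\in\mathbb{N}$. Ideals are assumed nontrivial, and $\mathscr{F}(\mathcal{I})=\{A\subseteq\mathbb{N}:\mathbb{N}\setminus A\in\mathcal{I}\}$ denotes the associated filter. A sequence $(x_n)$ in $X$ is $\mathcal{I}^{*}$-convergent to $x\in X$ if there exists $M=\{m_1<m_2<\cdots<m_k<\cdots\}\in\mathscr{F}(\mathcal{I})$ such that for every neighborhood $U$ of $x$ there exists $N\in\mathbb{N}$ with $x_{m_k}\in U$ for all $m_k>N$. For $A\subseteq X$, the $\mathcal{I}^{*}$-closure $\overline{A}^{\mathcal{I}^{*}}$ is the set of all $x\in X$ for which some sequence $(x_n)\subset A$ is $\mathcal{I}^{*}$-convergent to $x$. A set $F\subseteq X$ is $\mathcal{I}^{*}$-closed if $\overline{F}^{\mathcal{I}^{*}}=F$; a set is $\mathcal{I}^{*}$-open if its complement in $X$ is $\mathcal{I}^{*}$-closed.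 *)

theory Defs
  imports "HOL-Analysis.Abstract_Topology"
begin

definition ideal_on_nat :: "nat set set \<Rightarrow> bool" where
  "ideal_on_nat I \<longleftrightarrow>
     (\<forall>A\<in>I. \<forall>B\<in>I. A \<union> B \<in> I) \<and> (\<forall>A\<in>I. \<forall>B. B \<subseteq> A \<longrightarrow> B \<in> I)"

definition nontrivial_ideal :: "nat set set \<Rightarrow> bool" where
  "nontrivial_ideal I \<longleftrightarrow> ideal_on_nat I \<and> I \<noteq> {} \<and> UNIV \<notin> I"

(* Ideals are nontrivial by standing convention, so admissible ideals are too. *)
definition admissible_ideal :: "nat set set \<Rightarrow> bool" where
  "admissible_ideal I \<longleftrightarrow> nontrivial_ideal I \<and> (\<forall>n. {n} \<in> I)"

definition ideal_filter :: "nat set set \<Rightarrow> nat set set" where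
  "ideal_filter I = {A. UNIV - A \<in> I}"

(* Neighbourhoods need not be open. *)
definition neighbourhood_in :: "'a topology \<Rightarrow> 'a \<Rightarrow> 'a set \<Rightarrow> bool" where
  "neighbourhood_in X x U \<longleftrightarrow>
     U \<subseteq> topspace X \<and> (\<exists>V. openin X V \<and> x \<in> V \<and> V \<subseteq> U)"

(* The set M = {m_1 < m_2 < ...} is given by its strictly increasing enumeration m. *)
definition istar_convergent ::
    "'a topology \<Rightarrow> nat set set \<Rightarrow> (nat \<Rightarrow> 'a) \<Rightarrow> 'a \<Rightarrow> bool" where
  "istar_convergent X I s x \<longleftrightarrow>
     range s \<subseteq> topspace X \<and> x \<in> topspace X \<and>
     (\<exists>m :: nat \<Rightarrow> nat. strict_mono m \<and> range m \<in> ideal_filter I \<and>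
        (\<forall>U. neighbourhood_in X x U \<longrightarrow> (\<exists>N. \<forall>k. m k > N \<longrightarrow> s (m k) \<in> U)))"

definition istar_closure :: "'a topology \<Rightarrow> nat set set \<Rightarrow> 'a set \<Rightarrow> 'a set" where
  "istar_closure X I A = {x \<in> topspace X. \<exists>s. range s \<subseteq> A \<and> istar_convergent X I s x}"

definition istar_closed :: "'a topology \<Rightarrow> nat set set \<Rightarrow> 'a set \<Rightarrow> bool" where
  "istar_closed X I F \<longleftrightarrow> F \<subseteq> topspace X \<and> istar_closure X I F = F"

definition istar_open :: "'a topology \<Rightarrow> nat set set \<Rightarrow> 'a set \<Rightarrow> bool" where
  "istar_open X I U \<longleftrightarrow> U \<subseteq> topspace X \<and> istar_closed X I (topspace X - U)"

definition istar_topology :: "'a topology \<Rightarrow> nat set set \<Rightarrow> 'a set set" where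
  "istar_topology X I = {U \<in> Pow (topspace X). istar_open X I U}"

(* istopology alone does not fix the carrier. It already gives {} \<in> T, as the empty union. *)
definition topology_on :: "'a set \<Rightarrow> 'a set set \<Rightarrow> bool" where
  "topology_on S T \<longleftrightarrow> T \<subseteq> Pow S \<and> S \<in> T \<and> istopology (\<lambda>U. U \<in> T)"

end

theory Submission
  imports Defs "HOL-Analysis.Abstract_Limits"
begin

text \<open>Enumerating the filter set \<open>M\<close> turns \<open>\<I>\<^sup>*\<close>-convergence into ordinary
  convergence of a subsequence, and conversely \<open>M = \<nat>\<close> always lies in the filter. Hence the
  \<open>\<I>\<^sup>*\<close>-closure is the sequential closure, and the \<open>\<I>\<^sup>*\<close>-open sets are the sequentially open
  sets: those \<open>U\<close> for which every sequence converging to a point of \<open>U\<close> is eventually in \<open>U\<close>.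
  This last condition is visibly stable under finite intersections and arbitrary unions.\<close>

lemma istar_closure_eq_sequential_closure:
  assumes "{} \<in> I" and "A \<subseteq> topspace X"
  shows "istar_closure X I A = {x. \<exists>t. range t \<subseteq> A \<and> limitin X t x sequentially}"
proof (intro equalityI subsetI CollectI)
  fix x assume "x \<in> istar_closure X I A"
  then obtain s and m :: "nat \<Rightarrow> nat" where sA: "range s \<subseteq> A" and x: "x \<in> topspace X" and m: "strict_mono m"
    and conv: "\<And>U. neighbourhood_in X x U \<Longrightarrow> \<exists>N::nat. \<forall>k. m k > N \<longrightarrow> s (m k) \<in> U"
    unfolding istar_closure_def istar_convergent_def by blast
  have "limitin X (s \<circ> m) x sequentially"
    unfolding limitin_sequentially
  proof (intro conjI allI impI x)
    fix U assume "openin X U \<and> x \<in> U"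
    then have "neighbourhood_in X x U"
      unfolding neighbourhood_in_def using openin_subset by blast
    then obtain N where N: "\<And>k. m k > N \<Longrightarrow> s (m k) \<in> U"
      using conv by blast
    \<comment> \<open>The threshold \<open>N\<close> bounds the value \<open>m k\<close>, whereas
      ordinary convergence bounds the index \<open>k\<close>. Since k \<le> \<open>m k\<close> for a
      strictly increasing \<open>m\<close>, every index beyond \<open>N\<close> qualifies.\<close>
    have "(s \<circ> m) k \<in> U" if "k \<ge> Suc N" for k
      using N[of k] that strict_mono_imp_increasing[OF m, of k] by simp
    then show "\<exists>N. \<forall>n\<ge>N. (s \<circ> m) n \<in> U" by blast
  qed
  moreover have "range (s \<circ> m) \<subseteq> A" using sA by auto
  ultimately show "\<exists>t. range t \<subseteq> A \<and> limitin X t x sequentially" by blast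
next
  fix x assume "x \<in> {x. \<exists>t. range t \<subseteq> A \<and> limitin X t x sequentially}"
  then obtain t where tA: "range t \<subseteq> A" and lim: "limitin X t x sequentially" by blast
  \<comment> \<open>The witness for the filter set is all of the naturals, enumerated by
    \<open>id\<close>; its complement is \<open>{}\<close>, which lies in \<open>I\<close>.\<close>
  have "\<exists>N. \<forall>k. id k > N \<longrightarrow> t (id k) \<in> U" if "neighbourhood_in X x U" for U
  proof -
    obtain V where "openin X V" "x \<in> V" "V \<subseteq> U"
      using \<open>neighbourhood_in X x U\<close> unfolding neighbourhood_in_def by blast
    then show ?thesis
      using lim unfolding limitin_sequentially by (metis id_apply less_imp_le subsetD)
  qed
  moreover have "strict_mono (id :: nat \<Rightarrow> nat)" by (simp add: strict_mono_def)
  moreover have "range (id :: nat \<Rightarrow> nat) \<in> ideal_filter I"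
    using assms(1) by (simp add: ideal_filter_def)
  moreover have "x \<in> topspace X" using lim by (rule limitin_topspace)
  ultimately show "x \<in> istar_closure X I A"
    unfolding istar_closure_def istar_convergent_def using tA assms(2) by blast
qed

text \<open>If a sequence converging to a point of \<open>U\<close> leaves \<open>U\<close>
  infinitely often, its terms outside \<open>U\<close> form a subsequence in the complement with the
  same limit, so the complement is not closed. Conversely, a sequence in the complement is never in
  \<open>U\<close>, so its limit cannot lie in \<open>U\<close>.\<close>

lemma istar_open_iff_sequentially_open:
  assumes "{} \<in> I"
  shows "istar_open X I U \<longleftrightarrow> U \<subseteq> topspace X \<and>
    (\<forall>t. \<forall>x\<in>U. limitin X t x sequentially \<longrightarrow> eventually (\<lambda>n. t n \<in> U) sequentially)"
proof (intro iffI conjI allI ballI impI)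
  assume "istar_open X I U"
  then show "U \<subseteq> topspace X" by (simp add: istar_open_def)
  have closed: "x \<in> topspace X - U"
    if "range t \<subseteq> topspace X - U" "limitin X t x sequentially" for t x
    using \<open>istar_open X I U\<close> istar_closure_eq_sequential_closure[OF assms, of "topspace X - U" X] that
    unfolding istar_open_def istar_closed_def by blast
  fix t x assume x: "x \<in> U" and lim: "limitin X t x sequentially"
  show "eventually (\<lambda>n. t n \<in> U) sequentially"
  proof (rule ccontr)
    assume "\<not> ?thesis"
    then have "\<exists>\<^sub>\<infinity>n. t n \<notin> U"
      by (simp add: frequently_def cofinite_eq_sequentially)
    \<comment> \<open>A sequence with a limit in the sense of \<open>limitin\<close> may have terms
      outside the carrier. Testing convergence on the open set \<open>topspace X\<close> shows that
      there are only finitely many, so discarding them keeps infinitely many terms in the complement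
      of \<open>U\<close>.\<close>
    moreover have "\<forall>\<^sub>\<infinity>n. t n \<in> topspace X"
      using lim unfolding limitin_def cofinite_eq_sequentially by blast
    ultimately have "\<exists>\<^sub>\<infinity>n. t n \<notin> U \<and> t n \<in> topspace X"
      by (rule INFM_conjI)
    then have "infinite {n. t n \<in> topspace X - U}"
      by (simp add: frequently_cofinite conj_commute)
    then obtain r :: "nat \<Rightarrow> nat" where r: "strict_mono r" "\<And>n. t (r n) \<in> topspace X - U"
      using infinite_enumerate by blast
    have "limitin X (t \<circ> r) x sequentially"
      using limitin_subsequence[OF r(1) lim] .
    moreover have "range (t \<circ> r) \<subseteq> topspace X - U"
      using r(2) by (auto simp del: Diff_iff)
    ultimately have "x \<in> topspace X - U"
      by (intro closed)
    with x show False by simp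
  qed
next
  assume R: "U \<subseteq> topspace X \<and>
    (\<forall>t. \<forall>x\<in>U. limitin X t x sequentially \<longrightarrow> eventually (\<lambda>n. t n \<in> U) sequentially)"
  have "x \<in> topspace X - U"
    if t: "range t \<subseteq> topspace X - U" and lim: "limitin X t x sequentially" for t x
  proof -
    have "\<not> eventually (\<lambda>n. t n \<in> U) sequentially"
      using t unfolding eventually_sequentially by blast
    then show ?thesis using R lim limitin_topspace[OF lim] by blast
  qed
  \<comment> \<open>Constant sequences show that every set lies in its closure.\<close>
  moreover have "\<exists>t. range t \<subseteq> topspace X - U \<and> limitin X t x sequentially"
    if "x \<in> topspace X - U" for x
    using that by (intro exI[of _ "\<lambda>_. x"]) auto
  ultimately have "istar_closure X I (topspace X - U) = topspace X - U"
    using istar_closure_eq_sequential_closure[OF assms, of "topspace X - U" X] by blast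
  with R show "istar_open X I U"
    by (simp add: istar_open_def istar_closed_def)
qed

theorem theorem10:
  fixes X :: "'a topology" and I :: "nat set set"
  assumes "admissible_ideal I"
  shows "topology_on (topspace X) (istar_topology X I)"
proof -
  have "{} \<in> I"
    using assms unfolding admissible_ideal_def nontrivial_ideal_def ideal_on_nat_def by blast
  note seq_open = istar_open_iff_sequentially_open[OF this, of X]
  have mem: "U \<in> istar_topology X I \<longleftrightarrow> istar_open X I U" for U
    by (auto simp: istar_topology_def istar_open_def)
  \<comment> \<open>The carrier is itself an open neighbourhood of each limit.\<close>
  have "topspace X \<in> istar_topology X I"
    unfolding mem seq_open limitin_def by blast
  moreover have "U \<inter> V \<in> istar_topology X I"
    if "U \<in> istar_topology X I" "V \<in> istar_topology X I" for U V
    using that unfolding mem seq_open by (auto simp: eventually_conj_iff)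
  moreover have "\<Union>K \<in> istar_topology X I" if K: "\<forall>U\<in>K. U \<in> istar_topology X I" for K
    unfolding mem seq_open
  proof (intro conjI allI ballI impI)
    show "\<Union>K \<subseteq> topspace X" using K unfolding mem seq_open by blast
    fix t x assume "x \<in> \<Union>K" and lim: "limitin X t x sequentially"
    then obtain U where U: "U \<in> K" "x \<in> U" by blast
    then have "eventually (\<lambda>n. t n \<in> U) sequentially"
      using K lim unfolding mem seq_open by blast
    \<comment> \<open>Being eventually in the single member \<open>U\<close> that contains the limit
      is enough.\<close>
    then show "eventually (\<lambda>n. t n \<in> \<Union>K) sequentially"
      by (rule eventually_mono) (use U in blast)
  qed
  ultimately show ?thesis
    unfolding topology_on_def istopology_def by (auto simp: istar_topology_def)
qed

end
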